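(* Let $\mathcal{G}=(\mathcal{V},\mathcal{E})$ be a graph with fixed source nodes $\mathcal{S}\subset\mathcal{V}$ and target nodes $\mathcal{T}\subset\mathcal{V}$, and let $\beta_{ij}$ (for $(j,i)\in\mathcal{E}$) be flow attention weights on $\mathcal{G}$. Define $\psi_\beta$ for every directed edge $(j,i)\in\mathcal{E}$ as $$\psi_\beta(j,i)=\begin{cases}\beta_{ij}\displaystyle\sum_{k\in\mathcal{N}_{\text{in}}(j)}\psi_\beta(k,j), & \text{if } j\in\mathcal{V}\setminus(\mathcal{S}\cup\mathcal{T}),\\[2mm] \psi_0(j,i), & \text{otherwise},\end{cases}$$ where $\psi_0(j,i)$ is the absolute outgoing flow from a source or target node. Then $\psi_\beta$ is a flow on $\mathcal{G}$ that satisfies Kirchhoff's first law, i.e. $$\sum_{u\in\mathcal{N}_{\text{in}}(v)}\psi_\beta(u,v)=\sum_{u\in\mathcal{N}_{\text{out}}(v)}\psi_\beta(v,u)\qquad\text{for all } v\in\mathcal{V}\setminus(\mathcal{S}\cup\mathcal{T}).$$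
   Context: A directed graph is a pair $\mathcal{G}=(\mathcal{V},\mathcal{E})$ with node set $\mathcal{V}\subset\mathbb{N}$ and set of directed edges $\mathcal{E}\subseteq\mathcal{V}\times\mathcal{V}$; $(u,v)\in\mathcal{E}$ denotes the directed edge from $u$ to $v$. The incoming neighborhood of $v$ is $\mathcal{N}_{\text{in}}(v)=\{u\in\mathcal{V}:(u,v)\in\mathcal{E}\}$ and the outgoing neighborhood is $\mathcal{N}_{\text{out}}(v)=\{u\in\mathcal{V}:(v,u)\in\mathcal{E}\}$. For sources and targets $\mathcal{S},\mathcal{T}\subseteq\mathcal{V}$, a flow on $\mathcal{G}$ is a mapping $\psi:\mathcal{E}\to\mathbb{R}$ satisfying Kirchhoff's first law: $\sum_{u\in\mathcal{N}_{\text{in}}(v)}\psi(u,v)=\sum_{u\in\mathcal{N}_{\text{out}}(v)}\psi(v,u)$ for all $v\in\mathcal{V}\setminus(\mathcal{S}\cup\mathcal{T})$. Flow attention weights: each node $i$ carries a feature vector $\bm{h}_i\in\mathbb{R}^\rho$, $e:\mathbb{R}^\rho\times\mathbb{R}^\rho\to\mathbb{R}$ is a scoring function, $e_{ij}=e(\bm{h}_i,\bm{h}_j)$, and for each edge $(j,i)\in\mathcal{E}$ (from $j$ to $i$) $$\beta_{ij}=\frac{\exp(e_{ij})}{\sum_{k\in\mathcal{N}_{\text{out}}(j)}\exp(e_{kj})},$$ i.e. the scores are normalized by a softmax across the outgoing neighbors of $j$. The value $\psi_0(j,i)$ is the prescribed absolute flow leaving a source or target node $j$ along the edge $(j,i)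$.
   Formalization: Assumes neighborhoods are finite and that each node outside S∪T with an incoming edge has an outgoing edge; without the latter the claim fails (a single edge from a source to a dead end carrying flow 1). Stated for every ψ_β satisfying the defining equations. *)

theory Defs
  imports "HOL-Analysis.Analysis" "Graph_Theory.Pair_Digraph"
begin

definition in_nbhd :: "nat pair_pre_digraph \<Rightarrow> nat \<Rightarrow> nat set" where
  "in_nbhd G v = {u \<in> pverts G. (u, v) \<in> parcs G}"

definition out_nbhd :: "nat pair_pre_digraph \<Rightarrow> nat \<Rightarrow> nat set" where
  "out_nbhd G v = {u \<in> pverts G. (v, u) \<in> parcs G}"

(* A map from the edge set to the reals is represented by a total function on pairs of nodes;
   only its values on edges enter. *)
definition is_flow ::
  "nat pair_pre_digraph \<Rightarrow> nat set \<Rightarrow> nat set \<Rightarrow> (nat \<times> nat \<Rightarrow> real) \<Rightarrow> bool" where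
  "is_flow G S T \<psi> \<longleftrightarrow>
     (\<forall>v \<in> pverts G - (S \<union> T).
        (\<Sum>u \<in> in_nbhd G v. \<psi> (u, v)) = (\<Sum>u \<in> out_nbhd G v. \<psi> (v, u)))"

(* Index order: flow_attention G e h i j is the weight of the edge (j, i) from j to i; the softmax
   runs over the heads k of the edges leaving the tail j. *)
definition flow_attention ::
  "nat pair_pre_digraph \<Rightarrow> (real ^ 'rho \<Rightarrow> real ^ 'rho \<Rightarrow> real) \<Rightarrow> (nat \<Rightarrow> real ^ 'rho) \<Rightarrow>
     nat \<Rightarrow> nat \<Rightarrow> real" where
  "flow_attention G e h i j = exp (e (h i) (h j)) / (\<Sum>k \<in> out_nbhd G j. exp (e (h k) (h j)))"

(* The defining equations of the map on edges. On a graph with directed cycles they are an implicit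
   system rather than a recursion, so they are stated as a property of \<psi>. *)
definition flow_equations ::
  "nat pair_pre_digraph \<Rightarrow> nat set \<Rightarrow> nat set \<Rightarrow> (nat \<Rightarrow> nat \<Rightarrow> real) \<Rightarrow> (nat \<times> nat \<Rightarrow> real) \<Rightarrow>
     (nat \<times> nat \<Rightarrow> real) \<Rightarrow> bool" where
  "flow_equations G S T \<beta> \<psi>0 \<psi> \<longleftrightarrow>
     (\<forall>(j, i) \<in> parcs G.
        \<psi> (j, i) = (if j \<in> pverts G - (S \<union> T)
                     then \<beta> i j * (\<Sum>k \<in> in_nbhd G j. \<psi> (k, j))
                     else \<psi>0 (j, i)))"

end

theory Submission
  imports Defs
begin

text \<open>Conservation is local: at a node outside \<open>S\<close> and \<open>T\<close>, the
  equations split the total inflow among the outgoing edges in proportion to softmax weights. These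
  weights sum to 1 (\<open>sum_flow_attention\<close>), so the outflow equals the inflow. Only the
  equations at one node are used, with no recursion along edges, so directed cycles do no
  harm.\<close>

lemma sum_flow_attention:
  assumes "finite (out_nbhd G v)" and "out_nbhd G v \<noteq> {}"
  shows "(\<Sum>u \<in> out_nbhd G v. flow_attention G e h u v) = 1"
proof -
  \<comment> \<open>The softmax denominator must be nonzero to cancel; over an empty or infinite set
    the sum would be 0 by convention, and all weights would vanish.\<close>
  have "(\<Sum>k \<in> out_nbhd G v. exp (e (h k) (h v))) > 0"
    using assms by (intro sum_pos) auto
  then show ?thesis
    by (simp add: flow_attention_def flip: sum_divide_distrib)
qed

theorem lemma5p1:
  fixes G :: "nat pair_pre_digraph"
    and S T :: "nat set"
    and e :: "real ^ 'rho \<Rightarrow> real ^ 'rho \<Rightarrow> real"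
    and h :: "nat \<Rightarrow> real ^ 'rho"
    and \<psi>0 \<psi> :: "nat \<times> nat \<Rightarrow> real"
  assumes "pair_wf_digraph G"
    and "S \<subseteq> pverts G" and "T \<subseteq> pverts G"
    and finite_nbhds: "\<And>v. v \<in> pverts G \<Longrightarrow> finite (in_nbhd G v) \<and> finite (out_nbhd G v)"
    and no_dead_end: "\<And>v. v \<in> pverts G - (S \<union> T) \<Longrightarrow> in_nbhd G v \<noteq> {} \<Longrightarrow> out_nbhd G v \<noteq> {}"
    and "flow_equations G S T (flow_attention G e h) \<psi>0 \<psi>"
  shows "is_flow G S T \<psi>"
  unfolding is_flow_def
proof
  fix v
  assume v: "v \<in> pverts G - (S \<union> T)"
  let ?I = "\<Sum>k \<in> in_nbhd G v. \<psi> (k, v)"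
  \<comment> \<open>The factor \<open>?I\<close> does not depend on \<open>u\<close>, so it can be
    pulled out of the sum over outgoing edges.\<close>
  have "\<psi> (v, u) = flow_attention G e h u v * ?I" if "u \<in> out_nbhd G v" for u
    using assms(6) v that unfolding flow_equations_def out_nbhd_def by auto
  then have out: "(\<Sum>u \<in> out_nbhd G v. \<psi> (v, u)) =
      (\<Sum>u \<in> out_nbhd G v. flow_attention G e h u v) * ?I"
    by (simp add: sum_distrib_right)
  show "?I = (\<Sum>u \<in> out_nbhd G v. \<psi> (v, u))"
  proof (cases "out_nbhd G v = {}")
    case True
    \<comment> \<open>Without outgoing edges the weights sum to 0, not 1; balance holds because
      nothing flows in either.\<close>
    with no_dead_end[OF v] have "in_nbhd G v = {}" by blast
    with True show ?thesis by simp
  next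
    case False
    with finite_nbhds v have "(\<Sum>u \<in> out_nbhd G v. flow_attention G e h u v) = 1"
      by (intro sum_flow_attention) auto
    with out show ?thesis by simp
  qed
qed

end
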